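(* Let $\sigma$ be a permutation of $[k]$ for some $k\ge 1$. Let $P_\sigma(z)=\sum_{n\ge0}\alpha_n(\sigma)\frac{z^n}{n!}$, where $\alpha_n(\sigma)$ is the number of permutations in $\mathcal S_n$ that avoid $\sigma$ as a consecutive pattern, and let $T_\sigma$ be the number of draws of the random sequence $X_1,X_2,\dots$ until $\sigma$ is seen for the first time as a consecutive pattern. Then the expectation and variance of $T_\sigma$ are $$\mathbb E T_\sigma=P_\sigma(1),\qquad \mathbb V T_\sigma=2P_\sigma'(1)+P_\sigma(1)-P_\sigma(1)^2.$$
   Context: $\mathcal S_k$ is the set of permutations of $[k]=\{1,\dots,k\}$, written in one-line notation. For a sequence of distinct reals, $\mathrm{st}$ (standardization) replaces the smallest entry by $1$, the second smallest by $2$, etc. A consecutive occurrence of $\sigma\in\mathcal S_k$ in a sequence (or permutation) $y_1y_2\dots$ is a block of adjacent entries $y_i y_{i+1}\dots y_{i+k-1}$ with $\mathrm{st}(y_i\dots y_{i+k-1})=\sigma$. A permutation avoids $\sigma$ if it has no consecutive occurrence of $\sigma$. The sequence $X_1,X_2,\dots$ consists of i.i.d. continuous random variables (without loss of generality uniform on $[0,1]$). $T_\sigma$ is the smallest $j$ such that $X_1,\dots,X_j$ contains a consecutive occurrence of $\sigma$. *)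

theory Defs
  imports
    "HOL-Probability.Probability"
    "HOL-Analysis.FPS_Convergence"
    "HOL-Combinatorics.Multiset_Permutations"
    "HOL-Library.Sublist"
begin

text \<open>
  Permutations of \<open>[n]\<close> in one-line notation are the lists in
  \<open>permutations_of_set {1..n}\<close>.
\<close>

text \<open>
  Each entry is replaced by its rank. On a list with repeated entries the result is not a
  permutation, so such a list is never an occurrence of a pattern below.
\<close>
definition standardize :: "'a::linorder list \<Rightarrow> nat list" where
  "standardize xs = map (\<lambda>x. card {y \<in> set xs. y \<le> x}) xs"

text \<open>\<open>sublist\<close> is the library's relation for blocks of adjacent entries.\<close>
definition contains_consecutive :: "nat list \<Rightarrow> 'a::linorder list \<Rightarrow> bool" where
  "contains_consecutive \<sigma> ys \<longleftrightarrow> (\<exists>zs. sublist zs ys \<and> standardize zs = \<sigma>)"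

definition avoiders :: "nat list \<Rightarrow> nat \<Rightarrow> nat list set" where
  "avoiders \<sigma> n = {\<pi> \<in> permutations_of_set {1..n}. \<not> contains_consecutive \<sigma> \<pi>}"

definition avoid_egf :: "nat list \<Rightarrow> real fps" where
  "avoid_egf \<sigma> = Abs_fps (\<lambda>n. real (card (avoiders \<sigma> n)) / fact n)"

text \<open>
  The sequence is indexed from \<open>1\<close>; the value \<open>X 0\<close> is never used. If \<open>\<sigma>\<close> never occurs,
  the value is an unspecified constant.
\<close>
definition waiting_time :: "nat list \<Rightarrow> (nat \<Rightarrow> 'w \<Rightarrow> real) \<Rightarrow> 'w \<Rightarrow> nat" where
  "waiting_time \<sigma> X \<omega> = (LEAST j. contains_consecutive \<sigma> (map (\<lambda>i. X i \<omega>) [1..<Suc j]))"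

end

theory Submission
  imports Defs
begin

text \<open>
  Let \<open>T\<close> be the waiting time and let \<open>\<alpha>\<^sub>n\<close> be the number of permutations of \<open>[n]\<close> that avoid the
  pattern. The event \<open>n < T\<close> says that the first \<open>n\<close> draws avoid the pattern, which is a statement
  about their standardization. Since the draws are exchangeable and almost surely distinct, this
  standardization is a uniformly random permutation (\<open>prob_pattern_event\<close>), so the probability of
  \<open>n < T\<close> is \<open>\<alpha>\<^sub>n / n!\<close>, the coefficient of \<open>z ^ n\<close> in the generating function (\<open>prob_avoid\<close>).

  The moments of \<open>T\<close> are sums over its tail probabilities: the mean of \<open>T\<close> is \<open>\<Sum>n. \<alpha>\<^sub>n / n!\<close> and the
  mean of the square of \<open>T\<close> is \<open>\<Sum>n. (2 n + 1) \<alpha>\<^sub>n / n!\<close> (\<open>weighted_tail_sum\<close>). These are the value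
  of the generating function at \<open>1\<close> and twice its derivative there plus its value.

  What makes this legitimate is that the tails decay geometrically, because disjoint blocks of draws
  are independent (\<open>prob_avoid_le_power\<close>). The generating function thus converges beyond \<open>1\<close>, so
  that it can be differentiated there term by term; the decay also shows that the pattern almost
  surely occurs.
\<close>

section \<open>Standardization and relative order\<close>

lemma card_image_le_if_determined:
  assumes "finite J" and "\<And>a b. a \<in> J \<Longrightarrow> b \<in> J \<Longrightarrow> f a = f b \<Longrightarrow> g a = g b"
  shows "card (g ` J) \<le> card (f ` J)"
proof -
  have "g j = g (inv_into J f (f j))" if "j \<in> J" for j
    using that by (intro assms(2)) (auto simp: inv_into_into f_inv_into_f)
  then have "g ` J = (\<lambda>x. g (inv_into J f x)) ` (f ` J)"
    unfolding image_image by (rule image_cong[OF refl])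
  then show ?thesis
    using \<open>finite J\<close> by (simp add: card_image_le)
qed

text \<open>
  Standardization is a complete invariant of this relation. Unlike equality of standardizations
  it involves no cardinalities: it restricts to windows index by index, and it is a finite boolean
  combination of comparisons of two entries, which makes the pattern events measurable.
\<close>

definition order_iso :: "'a::linorder list \<Rightarrow> 'b::linorder list \<Rightarrow> bool" where
  "order_iso xs ys \<longleftrightarrow> length xs = length ys \<and>
     (\<forall>i<length xs. \<forall>j<length xs. xs ! i \<le> xs ! j \<longleftrightarrow> ys ! i \<le> ys ! j)"

lemma length_standardize [simp]: "length (standardize xs) = length xs"
  by (simp add: standardize_def)

text \<open>
  Replacing an entry by its rank preserves the order, because the sets of entries below \<open>a\<close> and
  below \<open>b\<close> are nested, strictly so when \<open>a \<noteq> b\<close>.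
\<close>

lemma order_iso_standardize: "order_iso (standardize xs) xs"
proof -
  have "card {y \<in> set xs. y \<le> a} \<le> card {y \<in> set xs. y \<le> b} \<longleftrightarrow> a \<le> b"
    if "a \<in> set xs" "b \<in> set xs" for a b
  proof (cases "a \<le> b")
    case True
    then show ?thesis by (auto intro!: card_mono)
  next
    case False
    then have "{y \<in> set xs. y \<le> b} \<subset> {y \<in> set xs. y \<le> a}"
      using that by (auto simp: psubset_eq)
    then have "card {y \<in> set xs. y \<le> b} < card {y \<in> set xs. y \<le> a}"
      by (intro psubset_card_mono) auto
    then show ?thesis using False by simp
  qed
  then show ?thesis by (auto simp: order_iso_def standardize_def)
qed

text \<open>
  The rank of the \<open>i\<close>-th entry counts the distinct values at the positions \<open>j\<close> whose entry is at most
  the \<open>i\<close>-th one. Order-isomorphic lists have the same such positions, with the same coincidences of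
  values among them, so the counts agree.
\<close>

lemma standardize_eq_iff: "standardize xs = standardize ys \<longleftrightarrow> order_iso xs ys"
proof
  assume "standardize xs = standardize ys"
  then show "order_iso xs ys"
    using order_iso_standardize[of xs] order_iso_standardize[of ys]
    by (auto simp: order_iso_def)
next
  assume iso: "order_iso xs ys"
  then have len: "length xs = length ys" by (simp add: order_iso_def)
  show "standardize xs = standardize ys"
  proof (rule nth_equalityI)
    fix i assume "i < length (standardize xs)"
    then have i: "i < length xs" by simp
    let ?J = "{j. j < length xs \<and> xs ! j \<le> xs ! i}"
    have xs: "{y \<in> set xs. y \<le> xs ! i} = (!) xs ` ?J"
      by (auto simp: in_set_conv_nth)
    have ys: "{y \<in> set ys. y \<le> ys ! i} = (!) ys ` ?J"
      using iso i len by (auto simp: in_set_conv_nth order_iso_def)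
    have kernel: "xs ! a = xs ! b \<longleftrightarrow> ys ! a = ys ! b" if "a \<in> ?J" "b \<in> ?J" for a b
      using iso that by (simp add: order_iso_def order.eq_iff)
    have "card ((!) xs ` ?J) = card ((!) ys ` ?J)"
      by (rule antisym; rule card_image_le_if_determined) (simp_all only: kernel, simp_all)
    then show "standardize xs ! i = standardize ys ! i"
      using i len xs ys by (simp add: standardize_def)
  qed (simp add: len)
qed

lemma standardize_permutation:
  assumes "\<pi> \<in> permutations_of_set {1..n}"
  shows "standardize \<pi> = \<pi>"
proof -
  have set: "set \<pi> = {1..n}" using assms by (simp add: permutations_of_set_def)
  have "{y \<in> set \<pi>. y \<le> x} = {1..x}" if "x \<in> set \<pi>" for x
    using that unfolding set by auto
  then show ?thesis unfolding standardize_def by (intro map_idI) simp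
qed

lemma distinct_order_iso: "order_iso xs ys \<Longrightarrow> distinct xs \<longleftrightarrow> distinct ys"
  unfolding order_iso_def distinct_conv_nth by (metis order.eq_iff)

lemma distinct_standardize_iff: "distinct (standardize xs) \<longleftrightarrow> distinct xs"
  by (rule distinct_order_iso[OF order_iso_standardize])

lemma standardize_in_permutations:
  assumes "distinct xs"
  shows "standardize xs \<in> permutations_of_set {1..length xs}"
proof -
  have dist: "distinct (standardize xs)"
    using assms by (simp add: distinct_standardize_iff)
  have "set (standardize xs) \<subseteq> {1..length xs}"
  proof
    fix r assume "r \<in> set (standardize xs)"
    then obtain x where x: "x \<in> set xs" "r = card {y \<in> set xs. y \<le> x}"
      by (auto simp: standardize_def)
    have "card {y \<in> set xs. y \<le> x} \<le> card (set xs)"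
      by (intro card_mono) auto
    moreover have "card {y \<in> set xs. y \<le> x} > 0"
      using x by (subst card_gt_0_iff) auto
    ultimately show "r \<in> {1..length xs}"
      using x card_length[of xs] by simp
  qed
  moreover have "card (set (standardize xs)) = length xs"
    using distinct_card[OF dist] by simp
  ultimately have "set (standardize xs) = {1..length xs}"
    by (intro card_subset_eq) auto
  with dist show ?thesis by (simp add: permutations_of_set_def)
qed

lemma standardize_permute_list:
  assumes "p permutes {..<length xs}"
  shows "standardize (permute_list p xs) = permute_list p (standardize xs)"
  using assms unfolding standardize_def by (simp add: permute_list_map)

lemma inj_permute_list:
  assumes "p permutes {..<n}" "length xs = n" "length ys = n" "permute_list p xs = permute_list p ys"
  shows "xs = ys"
proof -
  have "permute_list (inv p) (permute_list p zs) = zs" if "length zs = n" for zs :: "'b list"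
    using that assms(1) permute_list_compose[of "inv p" zs p]
    by (simp add: permutes_inv permutes_inv_o)
  then show ?thesis using assms by metis
qed

lemma contains_consecutive_mono:
  "sublist xs ys \<Longrightarrow> contains_consecutive \<sigma> xs \<Longrightarrow> contains_consecutive \<sigma> ys"
  unfolding contains_consecutive_def by (blast intro: sublist_order.order.trans)

lemma contains_consecutive_window:
  "contains_consecutive \<sigma> ys \<longleftrightarrow>
     (\<exists>i. i + length \<sigma> \<le> length ys \<and> standardize (take (length \<sigma>) (drop i ys)) = \<sigma>)"
proof
  assume "contains_consecutive \<sigma> ys"
  then obtain zs ps ss where ys: "ys = ps @ zs @ ss" and zs: "standardize zs = \<sigma>"
    by (auto simp: contains_consecutive_def sublist_def)
  have "length \<sigma> = length zs" using zs by auto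
  then show "\<exists>i. i + length \<sigma> \<le> length ys \<and> standardize (take (length \<sigma>) (drop i ys)) = \<sigma>"
    using zs by (intro exI[of _ "length ps"]) (simp add: ys)
next
  assume "\<exists>i. i + length \<sigma> \<le> length ys \<and> standardize (take (length \<sigma>) (drop i ys)) = \<sigma>"
  then show "contains_consecutive \<sigma> ys"
    unfolding contains_consecutive_def
    by (meson sublist_drop sublist_order.order.trans sublist_take)
qed

text \<open>
  This is what turns a question about random reals into a count of permutations: whether a pattern
  occurs depends on the standardization only.
\<close>

lemma contains_consecutive_standardize:
  "contains_consecutive \<sigma> (standardize ys) \<longleftrightarrow> contains_consecutive \<sigma> ys"
proof -
  have "order_iso (take l (drop i (standardize ys))) (take l (drop i ys))" for i l
    using order_iso_standardize[of ys] unfolding order_iso_def by (simp add: min_def split: if_splits)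
  then show ?thesis
    unfolding contains_consecutive_window standardize_eq_iff[symmetric] by simp
qed

lemma contains_consecutive_upt:
  "contains_consecutive \<sigma> (map f [1..<Suc n]) \<longleftrightarrow>
     (\<exists>i. i + length \<sigma> \<le> n \<and> standardize (map f [Suc i..<Suc i + length \<sigma>]) = \<sigma>)"
proof -
  have "take (length \<sigma>) (drop i [1..<Suc n]) = [Suc i..<Suc i + length \<sigma>]"
    if "i + length \<sigma> \<le> n" for i
    using that by (simp add: drop_upt take_upt del: upt_Suc)
  then show ?thesis
    unfolding contains_consecutive_window by (auto simp: take_map drop_map simp del: upt_Suc)
qed

section \<open>The relative order of i.i.d. draws\<close>

lemma sets_standardize_eq:
  fixes Y :: "'i \<Rightarrow> 'w \<Rightarrow> real"
  assumes Y: "\<And>i. i \<in> set js \<Longrightarrow> Y i \<in> borel_measurable N"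
    and \<pi>: "standardize \<pi> = \<pi>"
  shows "{\<omega> \<in> space N. standardize (map (\<lambda>i. Y i \<omega>) js) = \<pi>} \<in> sets N"
proof -
  have "standardize (map (\<lambda>i. Y i \<omega>) js) = \<pi> \<longleftrightarrow> length js = length \<pi> \<and>
      (\<forall>a\<in>{..<length js}. \<forall>b\<in>{..<length js}. Y (js ! a) \<omega> \<le> Y (js ! b) \<omega> \<longleftrightarrow> \<pi> ! a \<le> \<pi> ! b)" for \<omega>
    using standardize_eq_iff[of "map (\<lambda>i. Y i \<omega>) js" \<pi>] \<pi> by (auto simp: order_iso_def)
  moreover have "{\<omega> \<in> space N. \<forall>a\<in>{..<length js}. \<forall>b\<in>{..<length js}.
      Y (js ! a) \<omega> \<le> Y (js ! b) \<omega> \<longleftrightarrow> \<pi> ! a \<le> \<pi> ! b} \<in> sets N"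
  proof (intro sets.sets_Collect_finite_All finite_lessThan)
    fix a b assume "a \<in> {..<length js}" "b \<in> {..<length js}"
    then have [measurable]: "Y (js ! a) \<in> borel_measurable N" "Y (js ! b) \<in> borel_measurable N"
      using Y by auto
    show "{\<omega> \<in> space N. Y (js ! a) \<omega> \<le> Y (js ! b) \<omega> \<longleftrightarrow> \<pi> ! a \<le> \<pi> ! b} \<in> sets N"
      by measurable
  qed
  ultimately show ?thesis
    by (cases "length js = length \<pi>") simp_all
qed

text \<open>
  Independent draws from one distribution on the reals whose distribution function is continuous;
  the indices start at \<open>1\<close>.
\<close>

locale iid_continuous = prob_space M for M :: "'w measure" +
  fixes X :: "nat \<Rightarrow> 'w \<Rightarrow> real"
  assumes indep: "indep_vars (\<lambda>_. borel) X {1..}"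
    and ident: "\<And>i. i \<ge> 1 \<Longrightarrow> distr M borel (X i) = distr M borel (X 1)"
    and cont: "continuous_on UNIV (cdf (distr M borel (X 1)))"
begin

abbreviation law :: "real measure" where "law \<equiv> distr M borel (X 1)"

abbreviation pattern_event :: "nat list \<Rightarrow> nat list \<Rightarrow> 'w set" where
  "pattern_event js \<pi> \<equiv> {\<omega> \<in> space M. standardize (map (\<lambda>i. X i \<omega>) js) = \<pi>}"

lemma X_measurable: "i \<ge> 1 \<Longrightarrow> X i \<in> borel_measurable M"
  using indep by (auto simp: indep_vars_def)

lemma prob_space_law: "prob_space law"
  by (intro prob_space_distr X_measurable) simp

lemma law_singleton: "emeasure law {x} = 0"
proof -
  interpret law: prob_space law by (rule prob_space_law)
  interpret law: real_distribution law by unfold_locales simp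
  have "isCont (cdf law) x"
    using cont by (simp add: continuous_on_eq_continuous_at)
  then show ?thesis
    using law.isCont_cdf law.emeasure_eq_measure by simp
qed

text \<open>
  The joint distribution of two different draws is the square of their common law, and each section
  of the diagonal is a single point, which has measure zero.
\<close>

lemma AE_no_tie:
  assumes "i \<ge> 1" "j \<ge> 1" "i \<noteq> j"
  shows "AE \<omega> in M. X i \<omega> \<noteq> X j \<omega>"
proof -
  interpret law: prob_space law by (rule prob_space_law)
  note [measurable] = X_measurable[OF assms(1)] X_measurable[OF assms(2)]
  have "indep_var (PiM {i} (\<lambda>_. borel)) (\<lambda>\<omega>. restrict (\<lambda>i. X i \<omega>) {i})
                  (PiM {j} (\<lambda>_. borel)) (\<lambda>\<omega>. restrict (\<lambda>i. X i \<omega>) {j})"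
    using assms by (intro indep_var_restrict[OF indep]) auto
  then have "indep_var borel ((\<lambda>v. v i) \<circ> (\<lambda>\<omega>. restrict (\<lambda>i. X i \<omega>) {i}))
                  borel ((\<lambda>v. v j) \<circ> (\<lambda>\<omega>. restrict (\<lambda>i. X i \<omega>) {j}))"
    by (rule indep_var_compose) simp_all
  then have "indep_var borel (X i) borel (X j)"
    by (simp add: comp_def)
  then have joint: "distr M (borel \<Otimes>\<^sub>M borel) (\<lambda>\<omega>. (X i \<omega>, X j \<omega>)) = law \<Otimes>\<^sub>M law"
    using ident[OF assms(1)] ident[OF assms(2)] by (simp add: indep_var_distribution_eq)
  have diag: "{p. fst p = snd p} \<in> sets (borel \<Otimes>\<^sub>M (borel :: real measure))"
  proof -
    have "{p \<in> space (borel \<Otimes>\<^sub>M (borel :: real measure)). fst p = snd p} \<in> sets (borel \<Otimes>\<^sub>M (borel :: real measure))"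
      by measurable
    then show ?thesis by (simp add: space_pair_measure)
  qed
  have "emeasure M {\<omega> \<in> space M. X i \<omega> = X j \<omega>}
      = emeasure (distr M (borel \<Otimes>\<^sub>M borel) (\<lambda>\<omega>. (X i \<omega>, X j \<omega>))) {p. fst p = snd p}"
    by (subst emeasure_distr) (auto simp: diag intro!: arg_cong[where f="emeasure M"])
  also have "\<dots> = (\<integral>\<^sup>+x. emeasure law (Pair x -` {p. fst p = snd p}) \<partial>law)"
    unfolding joint using diag
    by (intro law.emeasure_pair_measure_alt) (simp cong: sets_pair_measure_cong)
  also have "\<dots> = (\<integral>\<^sup>+x. 0 \<partial>law)"
  proof (intro nn_integral_cong)
    fix x :: real
    have "Pair x -` {p. fst p = snd p} = {x}" by auto
    then show "emeasure law (Pair x -` {p. fst p = snd p}) = 0"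
      by (simp only: law_singleton)
  qed
  finally show ?thesis
    by (intro AE_I[of _ _ "{\<omega> \<in> space M. X i \<omega> = X j \<omega>}"]) auto
qed

lemma AE_distinct:
  assumes "distinct js" "set js \<subseteq> {1..}"
  shows "AE \<omega> in M. distinct (map (\<lambda>i. X i \<omega>) js)"
proof -
  have "AE \<omega> in M. \<forall>(i, j) \<in> {(i, j) \<in> set js \<times> set js. i \<noteq> j}. X i \<omega> \<noteq> X j \<omega>"
  proof (rule AE_finite_allI)
    show "finite {(i, j) \<in> set js \<times> set js. i \<noteq> j}"
      by (rule finite_subset[of _ "set js \<times> set js"]) auto
    fix p assume "p \<in> {(i, j) \<in> set js \<times> set js. i \<noteq> j}"
    then show "AE \<omega> in M. case p of (i, j) \<Rightarrow> X i \<omega> \<noteq> X j \<omega>"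
      using assms(2) AE_no_tie by (cases p) auto
  qed
  then show ?thesis
  proof eventually_elim
    case (elim \<omega>)
    then show ?case using assms(1) by (auto simp: distinct_map inj_on_def)
  qed
qed

lemma sets_pattern_event:
  assumes "set js \<subseteq> {1..}" and \<pi>: "standardize \<pi> = \<pi>"
  shows "pattern_event js \<pi> \<in> sets M"
proof (rule sets_standardize_eq[where Y = X, OF _ \<pi>])
  fix i assume "i \<in> set js"
  then show "random_variable borel (X i)"
    using assms(1) by (intro X_measurable) auto
qed

text \<open>
  The right-hand side depends on the indices only through their number. Hence the law of the
  standardization is the same along any two lists of distinct indices of equal length, in particular
  along two arrangements of the same indices: this is the exchangeability of the sequence.
\<close>

lemma prob_pattern_event_PiM:
  assumes "distinct js" "set js \<subseteq> {1..}" "js \<noteq> []" and \<pi>: "standardize \<pi> = \<pi>"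
  shows "prob (pattern_event js \<pi>) = measure (PiM {..<length js} (\<lambda>_. law))
    {v \<in> space (PiM {..<length js} (\<lambda>_. borel)). standardize (map v [0..<length js]) = \<pi>}"
    (is "_ = measure ?P ?E")
proof -
  let ?n = "length js"
  let ?V = "\<lambda>\<omega>. \<lambda>a\<in>{..<?n}. X (js ! a) \<omega>"
  have X [measurable]: "i \<in> set js \<Longrightarrow> X i \<in> borel_measurable M" for i
    using assms(2) by (auto intro!: X_measurable)
  have nth: "js ! a \<in> set js" if "a < ?n" for a using that by simp
  have "distr M (PiM (set js) (\<lambda>_. borel)) (\<lambda>\<omega>. \<lambda>i\<in>set js. X i \<omega>)
      = PiM (set js) (\<lambda>i. distr M borel (X i))"
    using assms(3) X indep_vars_subset[OF indep assms(2)]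
    by (subst indep_vars_iff_distr_eq_PiM'[symmetric]) auto
  also have "\<dots> = PiM (set js) (\<lambda>_. law)"
    using assms(2) by (intro PiM_cong refl ident) auto
  finally have joint: "distr M (PiM (set js) (\<lambda>_. borel)) (\<lambda>\<omega>. \<lambda>i\<in>set js. X i \<omega>)
      = PiM (set js) (\<lambda>_. law)" .
  have sets_P: "sets (PiM {..<?n} (\<lambda>_. law)) = sets (PiM {..<?n} (\<lambda>_. borel))"
    by (intro sets_PiM_cong) auto
  have "?P = distr (PiM (set js) (\<lambda>_. law)) ?P (\<lambda>w. \<lambda>a\<in>{..<?n}. w (js ! a))"
    using assms(1) prob_space_law
    by (intro distr_PiM_reindex[symmetric]) (auto simp: inj_on_def nth_eq_iff_index_eq)
  also have "\<dots> = distr (distr M (PiM (set js) (\<lambda>_. borel)) (\<lambda>\<omega>. \<lambda>i\<in>set js. X i \<omega>))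
      (PiM {..<?n} (\<lambda>_. borel)) (\<lambda>w. \<lambda>a\<in>{..<?n}. w (js ! a))"
    unfolding joint using sets_P by (intro distr_cong) auto
  also have "\<dots> = distr M (PiM {..<?n} (\<lambda>_. borel))
      ((\<lambda>w. \<lambda>a\<in>{..<?n}. w (js ! a)) \<circ> (\<lambda>\<omega>. \<lambda>i\<in>set js. X i \<omega>))"
    by (intro distr_distr) (auto intro!: measurable_restrict measurable_component_singleton)
  also have "(\<lambda>w. \<lambda>a\<in>{..<?n}. w (js ! a)) \<circ> (\<lambda>\<omega>. \<lambda>i\<in>set js. X i \<omega>) = ?V"
    by (auto simp: fun_eq_iff)
  finally have P: "?P = distr M (PiM {..<?n} (\<lambda>_. borel)) ?V" .
  have "?E \<in> sets (PiM {..<?n} (\<lambda>_. borel))"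
    by (rule sets_standardize_eq[where Y = "\<lambda>i v. v i"])
      (use \<pi> in \<open>simp_all add: measurable_component_singleton\<close>)
  moreover have "?V \<in> measurable M (PiM {..<?n} (\<lambda>_. borel))"
    by (intro measurable_restrict X nth) auto
  moreover have "map (?V \<omega>) [0..<?n] = map (\<lambda>i. X i \<omega>) js" for \<omega>
    by (auto intro: nth_equalityI)
  ultimately show ?thesis
    unfolding P by (subst measure_distr)
      (auto simp: space_PiM intro!: arg_cong[where f=prob])
qed

text \<open>
  All relative orders are equally likely. A rearrangement of the index list carries the event for one
  permutation to the event for any other, and by exchangeability it does not change the probability.
  Almost surely there are no ties, so the \<open>n!\<close> disjoint events of equal probability fill the space.
\<close>

lemma prob_pattern_event:
  assumes js: "distinct js" "set js \<subseteq> {1..}" and \<pi>: "\<pi> \<in> permutations_of_set {1..length js}"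
  shows "prob (pattern_event js \<pi>) = 1 / fact (length js)"
proof (cases "js = []")
  case True
  then show ?thesis using \<pi> by (simp add: standardize_def prob_space)
next
  case False
  let ?n = "length js" and ?S = "permutations_of_set {1..length js}"
  have same: "prob (pattern_event js \<rho>) = prob (pattern_event js \<pi>)" if \<rho>: "\<rho> \<in> ?S" for \<rho>
  proof -
    have len: "length \<pi> = ?n" "length \<rho> = ?n"
      using \<pi> \<rho> by (auto simp: length_finite_permutations_of_set)
    have "mset \<rho> = mset \<pi>"
      using \<pi> \<rho> by (metis permutations_of_setD mset_set_set)
    then obtain p where p: "p permutes {..<?n}" "permute_list p \<pi> = \<rho>"
      using len by (metis mset_eq_permutation)
    have "standardize (map (\<lambda>i. X i \<omega>) (permute_list p js)) =
        permute_list p (standardize (map (\<lambda>i. X i \<omega>) js))" for \<omega>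
      using p by (simp add: standardize_permute_list flip: permute_list_map)
    moreover have "permute_list p ys = \<rho> \<longleftrightarrow> ys = \<pi>" if "length ys = ?n" for ys
      using inj_permute_list[OF p(1) that len(1)] p(2) by metis
    ultimately have "pattern_event js \<pi> = pattern_event (permute_list p js) \<rho>"
      by simp
    moreover have "permute_list p js \<noteq> []"
      using False by (metis length_0_conv length_permute_list)
    then have "prob (pattern_event (permute_list p js) \<rho>) = prob (pattern_event js \<rho>)"
      using js False p(1) standardize_permutation[OF \<rho>]
      by (subst (1 2) prob_pattern_event_PiM) (auto simp: distinct_permute_list)
    ultimately show ?thesis by simp
  qed
  have meas: "pattern_event js \<rho> \<in> sets M" if "\<rho> \<in> ?S" for \<rho>
    using js(2) standardize_permutation[OF that] by (rule sets_pattern_event)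
  have "1 = prob (\<Union>\<rho>\<in>?S. pattern_event js \<rho>)"
  proof (rule sym, subst prob_eq_1)
    show "(\<Union>\<rho>\<in>?S. pattern_event js \<rho>) \<in> events" using meas by blast
    show "AE \<omega> in M. \<omega> \<in> (\<Union>\<rho>\<in>?S. pattern_event js \<rho>)"
      using AE_distinct[OF js] AE_space
    proof eventually_elim
      case (elim \<omega>)
      then show ?case using standardize_in_permutations[of "map (\<lambda>i. X i \<omega>) js"] by simp
    qed
  qed
  also have "\<dots> = (\<Sum>\<rho>\<in>?S. prob (pattern_event js \<rho>))"
    using meas by (intro finite_measure_finite_Union) (auto simp: disjoint_family_on_def)
  also have "\<dots> = fact ?n * prob (pattern_event js \<pi>)"
    using same by simp
  finally show ?thesis by (simp add: field_simps)
qed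

lemma sets_contains_event:
  assumes "standardize \<sigma> = \<sigma>"
  shows "{\<omega> \<in> space M. contains_consecutive \<sigma> (map (\<lambda>i. X i \<omega>) [1..<Suc n])} \<in> sets M"
proof -
  have "{\<omega> \<in> space M. contains_consecutive \<sigma> (map (\<lambda>i. X i \<omega>) [1..<Suc n])}
      = (\<Union>i\<in>{i. i + length \<sigma> \<le> n}. pattern_event [Suc i..<Suc i + length \<sigma>] \<sigma>)"
    unfolding contains_consecutive_upt by auto
  also have "\<dots> \<in> sets M"
  proof (rule sets.finite_UN)
    show "finite {i. i + length \<sigma> \<le> n}"
      by (rule finite_subset[of _ "{..n}"]) auto
    show "pattern_event [Suc i..<Suc i + length \<sigma>] \<sigma> \<in> sets M" for i
      using assms by (intro sets_pattern_event) auto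
  qed
  finally show ?thesis .
qed

text \<open>
  The coefficients of the generating function are therefore the tail probabilities of the waiting
  time: the standardization of the first \<open>n\<close> draws is a uniformly random permutation.
\<close>

lemma prob_avoid:
  assumes \<sigma>: "standardize \<sigma> = \<sigma>"
  shows "prob {\<omega> \<in> space M. \<not> contains_consecutive \<sigma> (map (\<lambda>i. X i \<omega>) [1..<Suc n])}
    = card (avoiders \<sigma> n) / fact n"
proof -
  let ?js = "[1..<Suc n]"
  have js: "distinct ?js" "set ?js \<subseteq> {1..}" "length ?js = n" by auto
  have fin: "finite (avoiders \<sigma> n)" by (auto simp: avoiders_def)
  have perm: "\<pi> \<in> permutations_of_set {1..length ?js}" if "\<pi> \<in> avoiders \<sigma> n" for \<pi>
    using that js(3) by (simp add: avoiders_def del: upt_Suc)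
  have meas: "pattern_event ?js \<pi> \<in> sets M" if "\<pi> \<in> avoiders \<sigma> n" for \<pi>
    using js standardize_permutation[OF perm[OF that]] by (intro sets_pattern_event)
  have "prob {\<omega> \<in> space M. \<not> contains_consecutive \<sigma> (map (\<lambda>i. X i \<omega>) ?js)}
      = prob (\<Union>\<pi>\<in>avoiders \<sigma> n. pattern_event ?js \<pi>)"
  proof (rule finite_measure_eq_AE)
    show "AE \<omega> in M. \<omega> \<in> {\<omega> \<in> space M. \<not> contains_consecutive \<sigma> (map (\<lambda>i. X i \<omega>) ?js)}
        \<longleftrightarrow> \<omega> \<in> (\<Union>\<pi>\<in>avoiders \<sigma> n. pattern_event ?js \<pi>)"
      using AE_distinct[OF js(1,2)] AE_space
    proof eventually_elim
      case (elim \<omega>)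
      let ?ys = "map (\<lambda>i. X i \<omega>) ?js"
      have "standardize ?ys \<in> permutations_of_set {1..n}"
        using standardize_in_permutations[OF elim(1)] js(3) by (simp del: upt_Suc)
      then have "standardize ?ys \<in> avoiders \<sigma> n \<longleftrightarrow> \<not> contains_consecutive \<sigma> ?ys"
        by (simp add: avoiders_def contains_consecutive_standardize del: upt_Suc)
      then show ?case using elim(2) by (simp del: upt_Suc)
    qed
    have "{\<omega> \<in> space M. \<not> contains_consecutive \<sigma> (map (\<lambda>i. X i \<omega>) ?js)}
      = space M - {\<omega> \<in> space M. contains_consecutive \<sigma> (map (\<lambda>i. X i \<omega>) ?js)}" by auto
    then show "{\<omega> \<in> space M. \<not> contains_consecutive \<sigma> (map (\<lambda>i. X i \<omega>) ?js)} \<in> sets M"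
      using sets_contains_event[OF \<sigma>] by (simp del: upt_Suc)
    show "(\<Union>\<pi>\<in>avoiders \<sigma> n. pattern_event ?js \<pi>) \<in> sets M"
      using fin meas by blast
  qed
  also have "\<dots> = (\<Sum>\<pi>\<in>avoiders \<sigma> n. prob (pattern_event ?js \<pi>))"
    using fin meas by (intro finite_measure_finite_Union) (auto simp: disjoint_family_on_def)
  also have "\<dots> = (\<Sum>\<pi>\<in>avoiders \<sigma> n. 1 / fact n)"
    using prob_pattern_event[OF js(1,2) perm] unfolding js(3) by (intro sum.cong) auto
  finally show ?thesis by (simp del: upt_Suc)
qed

section \<open>Geometric decay of the tails\<close>

text \<open>
  Cut the first \<open>n\<close> draws into \<open>n div k\<close> disjoint blocks of length \<open>k\<close>. If the pattern has not
  occurred, then none of these independent blocks shows it, and each shows it with probability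
  \<open>1 / k!\<close>.
\<close>

lemma prob_avoid_le_power:
  assumes \<sigma>: "\<sigma> \<in> permutations_of_set {1..k}" and k: "k \<ge> 1"
  shows "prob {\<omega> \<in> space M. \<not> contains_consecutive \<sigma> (map (\<lambda>i. X i \<omega>) [1..<Suc n])}
    \<le> (1 - 1 / fact k) ^ (n div k)"
proof (cases "n div k = 0")
  case True
  then show ?thesis by simp
next
  case False
  define B where "B j = [Suc (j * k)..<Suc (j * k) + k]" for j
  let ?J = "{..<n div k}" and ?L = "\<lambda>j. set (B j)"
  let ?V = "\<lambda>j \<omega>. restrict (\<lambda>i. X i \<omega>) (?L j)"
  let ?A = "\<lambda>j. {v \<in> space (PiM (?L j) (\<lambda>_. borel :: real measure)). standardize (map v (B j)) \<noteq> \<sigma>}"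
  have len: "length \<sigma> = k" using length_finite_permutations_of_set[OF \<sigma>] by simp
  have std: "standardize \<sigma> = \<sigma>" by (rule standardize_permutation[OF \<sigma>])
  have B: "distinct (B j)" "?L j \<subseteq> {1..}" "length (B j) = k" for j
    by (auto simp: B_def)
  have "disjoint_family_on ?L ?J"
  proof (unfold disjoint_family_on_def, intro ballI impI)
    fix a b :: nat assume "a \<noteq> b"
    \<comment> \<open>the number of the block can be read off from any of its indices\<close>
    have "(i - 1) div k = j" if "i \<in> ?L j" for i j
    proof -
      obtain d where "i = Suc (j * k + d)" "d < k"
        using \<open>i \<in> ?L j\<close> by (auto simp: B_def dest!: le_Suc_ex)
      then show ?thesis by simp
    qed
    then show "?L a \<inter> ?L b = {}" using \<open>a \<noteq> b\<close> by auto
  qed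
  then have ind: "indep_vars (\<lambda>j. PiM (?L j) (\<lambda>_. borel)) ?V ?J"
    using B by (intro indep_vars_restrict[OF indep]) auto
  have A: "?A j \<in> sets (PiM (?L j) (\<lambda>_. borel))" for j
  proof -
    let ?P = "PiM (?L j) (\<lambda>_. borel) :: (nat \<Rightarrow> real) measure"
    have "?A j = space ?P - {v \<in> space ?P. standardize (map v (B j)) = \<sigma>}" by auto
    also have "\<dots> \<in> sets ?P"
      using std by (intro sets.Diff sets.top sets_standardize_eq) (auto intro!: measurable_component_singleton)
    finally show ?thesis .
  qed
  have map_V: "map (?V j \<omega>) (B j) = map (\<lambda>i. X i \<omega>) (B j)" for j \<omega> by simp
  have vimage: "?V j -` ?A j \<inter> space M = space M - pattern_event (B j) \<sigma>" for j
    unfolding vimage_def by (auto simp: map_V space_PiM cong: map_cong)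
  have block: "prob (?V j -` ?A j \<inter> space M) = 1 - 1 / fact k" for j
    unfolding vimage using \<sigma>
    by (simp only: prob_compl[OF sets_pattern_event[OF B(2) std]] prob_pattern_event[OF B(1,2)] B(3))
  have "{\<omega> \<in> space M. \<not> contains_consecutive \<sigma> (map (\<lambda>i. X i \<omega>) [1..<Suc n])}
      \<subseteq> (\<Inter>j\<in>?J. ?V j -` ?A j \<inter> space M)"
  proof (intro subsetI INT_I)
    fix \<omega> j
    assume \<omega>: "\<omega> \<in> {\<omega> \<in> space M. \<not> contains_consecutive \<sigma> (map (\<lambda>i. X i \<omega>) [1..<Suc n])}"
      and j: "j \<in> ?J"
    have "Suc j * k \<le> n div k * k"
      using j by (intro mult_le_mono1) simp
    also have "\<dots> \<le> n" by (rule div_times_less_eq_dividend)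
    finally have "j * k + k \<le> n" by simp
    then have "standardize (map (\<lambda>i. X i \<omega>) (B j)) \<noteq> \<sigma>"
      using \<omega> unfolding contains_consecutive_upt len B_def by blast
    then show "\<omega> \<in> ?V j -` ?A j \<inter> space M"
      unfolding vimage using \<omega> by simp
  qed
  moreover have "(\<Inter>j\<in>?J. ?V j -` ?A j \<inter> space M) \<in> sets M"
    unfolding vimage using B std False
    by (intro sets.finite_INT sets.Diff sets_pattern_event) auto
  ultimately have "prob {\<omega> \<in> space M. \<not> contains_consecutive \<sigma> (map (\<lambda>i. X i \<omega>) [1..<Suc n])}
      \<le> prob (\<Inter>j\<in>?J. ?V j -` ?A j \<inter> space M)"
    by (rule finite_measure_mono)
  also have "\<dots> = (\<Prod>j\<in>?J. prob (?V j -` ?A j \<inter> space M))"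
    using False by (intro indep_varsD_finite[OF ind] A) auto
  also have "\<dots> = (1 - 1 / fact k) ^ (n div k)"
    unfolding block by simp
  finally show ?thesis .
qed

end

lemma fps_conv_radius_gt_1_if_geometric:
  fixes f :: "real fps"
  assumes t: "0 < t" "t < 1" and bound: "\<And>n. \<bar>fps_nth f n\<bar> \<le> C * t ^ n"
  shows "fps_conv_radius f > 1"
proof -
  \<comment> \<open>any point strictly between \<open>1\<close> and \<open>1 / t\<close> would do\<close>
  define z where "z = (1 + 1 / t) / 2"
  have "1 / t > 1" using t by simp
  then have z: "z > 1" "z * t < 1" using t by (auto simp: z_def field_simps)
  have "summable (\<lambda>n. C * (z * t) ^ n)"
    using z t by (intro summable_mult summable_geometric) simp
  then have "summable (\<lambda>n. fps_nth f n * z ^ n)"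
  proof (rule summable_comparison_test')
    fix n :: nat
    have "\<bar>fps_nth f n\<bar> * z ^ n \<le> C * t ^ n * z ^ n"
      using bound z by (intro mult_right_mono) auto
    then show "norm (fps_nth f n * z ^ n) \<le> C * (z * t) ^ n"
      using z by (simp add: abs_mult power_mult_distrib mult_ac)
  qed
  then have "fps_conv_radius f \<ge> norm z"
    unfolding fps_conv_radius_def by (rule conv_radius_geI)
  moreover have "ereal (norm z) > 1" using z by simp
  ultimately show ?thesis by (rule less_le_trans[rotated])
qed

lemma power_div_le_geometric:
  fixes r :: real
  assumes "0 \<le> r" "r < 1" "k \<ge> 1"
  obtains t C where "0 < t" "t < 1" "\<And>n. r ^ (n div k) \<le> C * t ^ n"
proof -
  \<comment> \<open>the root of \<open>r\<close> itself would not be positive if \<open>r = 0\<close>, which occurs for patterns of length one\<close>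
  define s where "s = max r (1 / 2)"
  define t where "t = root k s"
  have s: "0 < s" "s < 1" "r \<le> s" using assms by (auto simp: s_def)
  have t: "0 < t" "t < 1" "t ^ k = s" using s assms by (auto simp: t_def)
  have "r ^ (n div k) \<le> (1 / s) * t ^ n" for n
  proof -
    have "r ^ (n div k) \<le> s ^ (n div k)"
      using s assms by (intro power_mono)
    then have "s * r ^ (n div k) \<le> t ^ k * (t ^ k) ^ (n div k)"
      using s t by simp
    also have "\<dots> \<le> t ^ (n mod k) * (t ^ k) ^ (n div k)"
      using t assms by (intro mult_right_mono power_decreasing) (auto simp: less_imp_le)
    also have "\<dots> = t ^ n"
      by (simp flip: power_mult power_add)
    finally show ?thesis using s by (simp add: field_simps)
  qed
  then show ?thesis using that t by blast
qed

section \<open>Moments as tail sums\<close>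

text \<open>
  Write the sum as a series over all \<open>n\<close> of \<open>w n\<close> times the indicator of \<open>n < T\<close> and interchange it
  with the expectation. Constant weights give the mean of \<open>T\<close>; the weights \<open>2 n + 1\<close> give its second
  moment, because the first \<open>m\<close> odd numbers add up to the square of \<open>m\<close>.
\<close>

lemma (in prob_space) weighted_tail_sum:
  fixes T :: "'a \<Rightarrow> nat" and w :: "nat \<Rightarrow> real"
  assumes T: "T \<in> measurable M (count_space UNIV)" and w: "\<And>n. w n \<ge> 0"
    and summ: "summable (\<lambda>n. w n * prob {\<omega> \<in> space M. n < T \<omega>})"
  shows "integrable M (\<lambda>\<omega>. \<Sum>n<T \<omega>. w n)"
    and "expectation (\<lambda>\<omega>. \<Sum>n<T \<omega>. w n) = (\<Sum>n. w n * prob {\<omega> \<in> space M. n < T \<omega>})"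
proof -
  note [measurable] = T
  let ?E = "\<lambda>n. {\<omega> \<in> space M. n < T \<omega>}"
  let ?f = "\<lambda>n \<omega>. w n * indicator (?E n) \<omega> :: real"
  have int: "integrable M (?f n)" for n
    by (intro integrable_mult_right integrable_real_indicator) (auto simp: emeasure_eq_measure)
  have exp: "expectation (?f n) = w n * prob (?E n)" for n
    by simp
  have fin: "(\<Sum>n<T \<omega>. w n) = (\<Sum>n. ?f n \<omega>)" if "\<omega> \<in> space M" for \<omega>
  proof -
    have "(\<Sum>n. ?f n \<omega>) = (\<Sum>n<T \<omega>. ?f n \<omega>)"
      by (rule suminf_finite) auto
    also have "\<dots> = (\<Sum>n<T \<omega>. w n)"
      using that by (intro sum.cong) auto
    finally show ?thesis by simp
  qed
  have ptw: "AE \<omega> in M. summable (\<lambda>n. norm (?f n \<omega>))"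
  proof (rule AE_I2)
    fix \<omega>
    show "summable (\<lambda>n. norm (?f n \<omega>))"
      by (rule summable_finite[of "{..<T \<omega>}"]) auto
  qed
  have norms: "summable (\<lambda>n. \<integral>\<omega>. norm (?f n \<omega>) \<partial>M)"
    using summ w by (simp add: abs_mult)
  show "integrable M (\<lambda>\<omega>. \<Sum>n<T \<omega>. w n)"
    using integrable_suminf[OF int ptw norms]
    by (simp only: Bochner_Integration.integrable_cong[OF refl fin])
  show "expectation (\<lambda>\<omega>. \<Sum>n<T \<omega>. w n) = (\<Sum>n. w n * prob (?E n))"
    using integral_suminf[OF int ptw norms] fin exp by (simp cong: Bochner_Integration.integral_cong)
qed

section \<open>The waiting time\<close>

theorem theorem2p1:
  fixes M :: "'w measure" and X :: "nat \<Rightarrow> 'w \<Rightarrow> real" and \<sigma> :: "nat list" and k :: nat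
  assumes "prob_space M"
    and "prob_space.indep_vars M (\<lambda>_. borel) X {1..}"
    and "\<And>i. i \<ge> 1 \<Longrightarrow> distr M borel (X i) = distr M borel (X 1)"
    and "continuous_on UNIV (cdf (distr M borel (X 1)))"
    and "k \<ge> 1" and "\<sigma> \<in> permutations_of_set {1..k}"
  shows "(AE \<omega> in M. \<exists>j. contains_consecutive \<sigma> (map (\<lambda>i. X i \<omega>) [1..<Suc j])) \<and>
    integrable M (\<lambda>\<omega>. real (waiting_time \<sigma> X \<omega>)) \<and>
    integrable M (\<lambda>\<omega>. (real (waiting_time \<sigma> X \<omega>))\<^sup>2) \<and>
    fps_conv_radius (avoid_egf \<sigma>) > 1 \<and>
    prob_space.expectation M (\<lambda>\<omega>. real (waiting_time \<sigma> X \<omega>)) = eval_fps (avoid_egf \<sigma>) 1 \<and>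
    prob_space.variance M (\<lambda>\<omega>. real (waiting_time \<sigma> X \<omega>)) =
      2 * deriv (eval_fps (avoid_egf \<sigma>)) 1 + eval_fps (avoid_egf \<sigma>) 1
        - (eval_fps (avoid_egf \<sigma>) 1)\<^sup>2"
proof -
  interpret iid_continuous M X
    using assms by (intro iid_continuous.intro iid_continuous_axioms.intro)
  note \<sigma> = \<open>\<sigma> \<in> permutations_of_set {1..k}\<close>
  have std: "standardize \<sigma> = \<sigma>" by (rule standardize_permutation[OF \<sigma>])
  define hit where "hit n \<omega> \<longleftrightarrow> contains_consecutive \<sigma> (map (\<lambda>i. X i \<omega>) [1..<Suc n])" for n \<omega>
  define a where "a n = card (avoiders \<sigma> n) / (fact n :: real)" for n
  let ?F = "avoid_egf \<sigma>" and ?T = "waiting_time \<sigma> X"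
  have nth: "fps_nth ?F n = a n" for n by (simp add: avoid_egf_def a_def)
  have T: "?T \<omega> = (LEAST j. hit j \<omega>)" for \<omega> by (simp add: waiting_time_def hit_def)
  have prob_miss: "prob {\<omega> \<in> space M. \<not> hit n \<omega>} = a n" for n
    unfolding hit_def a_def by (rule prob_avoid[OF std])
  have hit_sets: "{\<omega> \<in> space M. hit n \<omega>} \<in> sets M" for n
    unfolding hit_def by (rule sets_contains_event[OF std])
  then have hit_meas [measurable]: "Measurable.pred M (hit n)" for n
    by (simp add: pred_def)
  have T_meas [measurable]: "?T \<in> measurable M (count_space UNIV)"
    unfolding T[abs_def] by measurable
  have hit_mono: "hit m \<omega> \<Longrightarrow> m \<le> n \<Longrightarrow> hit n \<omega>" for m n \<omega>
  proof -
    assume "hit m \<omega>" "m \<le> n"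
    have "[1..<Suc n] = [1..<Suc m] @ [Suc m..<Suc n]"
      using upt_add_eq_append[of 1 "Suc m" "n - m"] \<open>m \<le> n\<close> by (simp del: upt_Suc)
    then have "sublist (map (\<lambda>i. X i \<omega>) [1..<Suc m]) (map (\<lambda>i. X i \<omega>) [1..<Suc n])"
      by (simp del: upt_Suc)
    then show "hit n \<omega>"
      using \<open>hit m \<omega>\<close> unfolding hit_def by (rule contains_consecutive_mono)
  qed

  \<comment> \<open>\<open>r\<close> is the probability that a block of \<open>k\<close> draws does not show the pattern\<close>
  define r :: real where "r = 1 - 1 / fact k"
  have r: "0 \<le> r" "r < 1" by (auto simp: r_def)
  have a_le: "a n \<le> r ^ (n div k)" for n
    using prob_avoid_le_power[OF \<sigma> \<open>k \<ge> 1\<close>, of n] prob_miss[of n] by (simp add: hit_def r_def del: upt_Suc)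
  have a_nonneg: "a n \<ge> 0" for n by (simp add: a_def)
  obtain t C where tC: "0 < t" "t < 1" "\<And>n. r ^ (n div k) \<le> C * t ^ n"
    using power_div_le_geometric[OF r \<open>k \<ge> 1\<close>] by blast
  have radius: "fps_conv_radius ?F > 1"
    using tC a_le a_nonneg by (intro fps_conv_radius_gt_1_if_geometric[of t _ C]) (auto simp: nth intro: order_trans)

  have radius1: "ereal (norm (1::real)) < fps_conv_radius ?F"
    using radius by (simp add: one_ereal_def)

  have AE_hit: "AE \<omega> in M. \<exists>j. hit j \<omega>"
  proof -
    have "summable a" using summable_fps[OF radius1] by (simp add: nth)
    then have "a \<longlonglongrightarrow> 0" by (rule summable_LIMSEQ_zero)
    have le: "prob {\<omega> \<in> space M. \<not> (\<exists>j. hit j \<omega>)} \<le> a n" for n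
      unfolding prob_miss[symmetric] by (intro finite_measure_mono) auto
    have "prob {\<omega> \<in> space M. \<not> (\<exists>j. hit j \<omega>)} \<le> 0"
      using le by (intro LIMSEQ_le_const[OF \<open>a \<longlonglongrightarrow> 0\<close>]) auto
    then have "prob {\<omega> \<in> space M. \<not> (\<exists>j. hit j \<omega>)} = 0"
      using measure_nonneg by (rule antisym)
    then show ?thesis
      by (subst AE_iff_measurable[OF _ refl]) (auto simp: emeasure_eq_measure)
  qed
  have tail: "prob {\<omega> \<in> space M. n < ?T \<omega>} = a n" for n
    unfolding prob_miss[symmetric]
  proof (rule finite_measure_eq_AE)
    show "AE \<omega> in M. \<omega> \<in> {\<omega> \<in> space M. n < ?T \<omega>} \<longleftrightarrow> \<omega> \<in> {\<omega> \<in> space M. \<not> hit n \<omega>}"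
      using AE_hit
    proof eventually_elim
      case (elim \<omega>)
      then have "hit (?T \<omega>) \<omega>" unfolding T by (rule LeastI_ex)
      then have "n < ?T \<omega> \<longleftrightarrow> \<not> hit n \<omega>"
        using hit_mono[of "?T \<omega>" \<omega> n] not_less_Least[of n "\<lambda>j. hit j \<omega>"] unfolding T by force
      then show ?case by simp
    qed
  qed measurable

  have sums0: "a sums eval_fps ?F 1"
    using sums_eval_fps[OF radius1] by (simp add: nth)
  have sums1: "(\<lambda>n. real n * a n) sums deriv (eval_fps ?F) 1"
  proof -
    have "(\<lambda>n. fps_nth (fps_deriv ?F) n * 1 ^ n) sums eval_fps (fps_deriv ?F) 1"
      by (rule sums_eval_fps) (rule less_le_trans[OF radius1 fps_conv_radius_deriv])
    then have "(\<lambda>n. real (Suc n) * a (Suc n)) sums deriv (eval_fps ?F) 1"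
      using eval_fps_deriv[OF radius1] by (simp add: nth)
    then show ?thesis by (subst (asm) sums_Suc_iff) simp
  qed
  have sums2: "(\<lambda>n. (2 * real n + 1) * a n) sums (2 * deriv (eval_fps ?F) 1 + eval_fps ?F 1)"
    using sums_add[OF sums_mult[OF sums1, of 2] sums0] by (simp add: algebra_simps)
  have squares: "(\<Sum>n<m. 2 * real n + 1) = (real m)\<^sup>2" for m
    by (induction m) (auto simp: power2_eq_square algebra_simps)
  have int1: "integrable M (\<lambda>\<omega>. real (?T \<omega>))"
    and exp1: "expectation (\<lambda>\<omega>. real (?T \<omega>)) = eval_fps ?F 1"
    using weighted_tail_sum[OF T_meas, of "\<lambda>_. 1"] sums0 by (auto simp: tail sums_iff)
  have int2: "integrable M (\<lambda>\<omega>. (real (?T \<omega>))\<^sup>2)"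
    and exp2: "expectation (\<lambda>\<omega>. (real (?T \<omega>))\<^sup>2) = 2 * deriv (eval_fps ?F) 1 + eval_fps ?F 1"
    using weighted_tail_sum[OF T_meas, of "\<lambda>n. 2 * real n + 1"] sums2
    by (auto simp: tail sums_iff squares)
  have var: "variance (\<lambda>\<omega>. real (?T \<omega>)) =
      2 * deriv (eval_fps ?F) 1 + eval_fps ?F 1 - (eval_fps ?F 1)\<^sup>2"
    using variance_eq[OF int1 int2] exp1 exp2 by simp
  show ?thesis
    using AE_hit int1 int2 radius exp1 var unfolding hit_def by blast
qed

end
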